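(* Let $\mathcal{P}$ be a finite index set, $\{A_p : p\in\mathcal{P}\}$ a collection of real $n\times n$ matrices, each either stable or unstable, and $\mathcal{I}=\{I_q : q\in\mathcal{Q}\}$ a nonempty compact set of nonzero real $n\times n$ matrices. Let $\mathcal{G}$ be a directed graph on the subsystems. For each $p\in\mathcal{P}$ fix a complex Jordan decomposition $A_p=P_pJ_pP_p^{-1}$ and constants $c_p>0$ and $\lambda_p^*>0$ (if $p\in\mathfrak{s}$) or $\mu_p^*>0$ (if $p\in\mathfrak{u}$) such that, for all $t>0$, $\|e^{J_pt}\|\le c_pe^{-\lambda_p^*t}$ if $p\in\mathfrak{s}$ and $\|e^{J_pt}\|\le c_pe^{\mu_p^*t}$ if $p\in\mathfrak{u}$. Set $$\tau_p=\max_{q:(p,q)\in\mathcal{E}(\mathcal{G})}\max_{M\in\mathcal{I}}\frac{\ln\left(c_p\,\|P_q^{-1}MP_p\|\right)}{\lambda_p^*}\ (p\in\mathfrak{s}),\qquad \eta_p=-\max_{q:(p,q)\in\mathcal{E}(\mathcal{G})}\max_{M\in\mathcal{I}}\frac{\ln\left(c_p\,\|P_q^{-1}MP_p\|\right)}{\mu_p^*}\ (p\in\mathfrak{u}).$$ Then for all $\sigma\in\mathcal{S}^{\mathcal{G}}\cap\mathcal{S}^{M}\left(\{\tau_p\}_{p\in\mathfrak{s}},\{\eta_p\}_{p\in\mathfrak{u}}\right)$ the impulsive switched system $\dot x(t)=A_{\sigma(t)}x(t)$, $x(t_k)=I_{\omega(t_k)}\,x(t_k^-)$ ($k\ge1$)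 is stable under arbitrary impulses, i.e. stable for every function $\omega:\{t_1,t_2,\dots\}\to\mathcal{Q}$.
   Context: A real matrix is called stable if all its eigenvalues have negative real part, and unstable if at least one eigenvalue has positive real part; $\mathfrak{s},\mathfrak{u}\subseteq\mathcal{P}$ are the sets of indices $p$ with $A_p$ stable, resp. unstable. $\|\cdot\|$ is the Euclidean norm for vectors and the spectral norm for matrices. A switching signal is a right-continuous piecewise constant function $\sigma:[0,\infty)\to\mathcal{P}$ whose set of discontinuities $\{t_k\}_{k\ge1}$ (switching times) is an increasing sequence with $t_k\uparrow\infty$; put $t_0=0$. $\mathcal{G}$ is a directed graph with vertices the subsystems $A_p$, identified with $p\in\mathcal{P}$, such that every $p$ has at least one outgoing edge $(p,q)\in\mathcal{E}(\mathcal{G})$. $\mathcal{S}^{\mathcal{G}}$ is the set of $\mathcal{G}$-admissible switching signals, i.e. those with $(\sigma(t_{k-1}),\sigma(t_k))\in\mathcal{E}(\mathcal{G})$ for all $k\ge1$. $\mathcal{S}^{M}(\{\tau_p\}_{p\in\mathfrak{s}},\{\eta_p\}_{p\in\mathfrak{u}})$ is the set of switching signals such that for all $k\ge0$: $t_{k+1}-t_k\ge\tau_{\sigma(t_k)}$ if $\sigma(t_k)\in\mathfrak{s}$, and $t_{k+1}-t_k\le\eta_{\sigma(t_k)}$ if $\sigma(t_k)\in\mathfrak{u}$. In the impulsive switched system, $\dot x=A_{\sigma(t)}x$ holds on each $[t_{k-1},t_k)$ and $x(t_k^-)=\lim_{t\to t_k^-}x(t)$. The system (for fixed $\sigma,\omega$)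 is stable if for every $\epsilon>0$ there is $\delta>0$ such that $\|x(0)\|<\delta$ implies $\|x(t)\|<\epsilon$ for all $t>0$. *)

theory Defs
  imports
    "Jordan_Normal_Form.Jordan_Normal_Form"
    "HOL-Analysis.Analysis"
begin

(* Only jordan_matrix and entry access $$ are used from Jordan_Normal_Form; all other matrices are
   those of HOL-Analysis. *)
hide_type (open) Matrix.vec
hide_const (open) Matrix.vec Matrix.mat Matrix.row Matrix.rows Matrix.vec_index
no_notation Matrix.vec_index (infixl \<open>$\<close> 100)

section \<open>Matrices\<close>

definition cmat :: "real^'n^'m \<Rightarrow> complex^'n^'m" where
  "cmat A = map_matrix complex_of_real A"

(* The eigenvalues of a real matrix are its complex ones. *)
definition eigenvalues :: "real^'n^'n \<Rightarrow> complex set" where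
  "eigenvalues A = {z. \<exists>v. v \<noteq> 0 \<and> cmat A *v v = z *s v}"

definition stable_matrix :: "real^'n^'n \<Rightarrow> bool" where
  "stable_matrix A \<longleftrightarrow> (\<forall>z\<in>eigenvalues A. Re z < 0)"

definition unstable_matrix :: "real^'n^'n \<Rightarrow> bool" where
  "unstable_matrix A \<longleftrightarrow> (\<exists>z\<in>eigenvalues A. Re z > 0)"

(* The norm of the type complex^'n^'n is the Frobenius norm, hence the operator norm here. *)
definition spectral_norm :: "complex^'n^'m \<Rightarrow> real" where
  "spectral_norm A = onorm ((*v) A)"

primrec matrix_pow :: "'a::semiring_1^'n^'n \<Rightarrow> nat \<Rightarrow> 'a^'n^'n" where
  "matrix_pow A 0 = mat 1"
| "matrix_pow A (Suc k) = A ** matrix_pow A k"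

definition matrix_exp :: "complex^'n^'n \<Rightarrow> complex^'n^'n" where
  "matrix_exp A = (\<Sum>k. (1 / fact k) *\<^sub>R matrix_pow A k)"

(* The index type 'n carries no order, so a Jordan matrix is one with respect to some numbering
   idx of 'n by 0, ..., n - 1. The list n_as consists of the sizes and eigenvalues of the blocks. *)
definition is_jordan_matrix :: "complex^'n^'n \<Rightarrow> bool" where
  "is_jordan_matrix J \<longleftrightarrow> (\<exists>idx n_as. bij_betw idx (UNIV :: 'n set) {..<CARD('n)} \<and>
     0 \<notin> fst ` set n_as \<and> sum_list (map fst n_as) = CARD('n) \<and>
     (\<forall>i j. J $ i $ j = jordan_matrix n_as $$ (idx i, idx j)))"

definition jordan_decomposition ::
    "real^'n^'n \<Rightarrow> complex^'n^'n \<Rightarrow> complex^'n^'n \<Rightarrow> bool" where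
  "jordan_decomposition A P J \<longleftrightarrow>
     is_jordan_matrix J \<and> invertible P \<and> cmat A = P ** J ** matrix_inv P"

section \<open>Switching signals\<close>

definition discontinuities :: "(real \<Rightarrow> 'p) \<Rightarrow> real set" where
  "discontinuities \<sigma> = {s. 0 \<le> s \<and> \<not> (\<forall>\<^sub>F r in at s within {0..}. \<sigma> r = \<sigma> s)}"

(* Signals live on [0, \<infinity>); the values of \<sigma> at negative times are irrelevant. The sequence t,
   consisting of t 0 = 0 and the switching times t 1 < t 2 < ..., is determined by \<sigma>. Continuity
   refers to the discrete topology on the index set. *)
definition switching_signal :: "(real \<Rightarrow> 'p) \<Rightarrow> (nat \<Rightarrow> real) \<Rightarrow> bool" where
  "switching_signal \<sigma> t \<longleftrightarrow>
     t 0 = 0 \<and> strict_mono t \<and> filterlim t at_top sequentially \<and>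
     discontinuities \<sigma> = t ` {1..} \<and>
     (\<forall>s\<ge>0. \<forall>\<^sub>F r in at_right s. \<sigma> r = \<sigma> s) \<and>
     (\<forall>k. \<sigma> constant_on {t k..<t (Suc k)})"

definition admissible :: "('p \<times> 'p) set \<Rightarrow> (real \<Rightarrow> 'p) \<Rightarrow> (nat \<Rightarrow> real) \<Rightarrow> bool" where
  "admissible E \<sigma> t \<longleftrightarrow> (\<forall>k\<ge>1. (\<sigma> (t (k - 1)), \<sigma> (t k)) \<in> E)"

definition dwell_flee ::
    "'p set \<Rightarrow> 'p set \<Rightarrow> ('p \<Rightarrow> real) \<Rightarrow> ('p \<Rightarrow> real) \<Rightarrow> (real \<Rightarrow> 'p) \<Rightarrow> (nat \<Rightarrow> real) \<Rightarrow> bool" where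
  "dwell_flee S U \<tau> \<eta> \<sigma> t \<longleftrightarrow>
     (\<forall>k. (\<sigma> (t k) \<in> S \<longrightarrow> t (k + 1) - t k \<ge> \<tau> (\<sigma> (t k))) \<and>
          (\<sigma> (t k) \<in> U \<longrightarrow> t (k + 1) - t k \<le> \<eta> (\<sigma> (t k))))"

section \<open>Impulsive switched systems\<close>

(* The derivative within {t k..<t (Suc k)} is one-sided at the left endpoint. Only the values of
   \<omega> at the switching times t 1, t 2, ... matter. *)
definition is_solution ::
    "('p \<Rightarrow> real^'n^'n) \<Rightarrow> ('q \<Rightarrow> real^'n^'n) \<Rightarrow> (real \<Rightarrow> 'p) \<Rightarrow> (nat \<Rightarrow> real) \<Rightarrow> (real \<Rightarrow> 'q) \<Rightarrow>
      (real \<Rightarrow> real^'n) \<Rightarrow> bool" where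
  "is_solution A I \<sigma> t \<omega> x \<longleftrightarrow>
     (\<forall>k. \<forall>s\<in>{t k..<t (Suc k)}.
        (x has_vector_derivative A (\<sigma> s) *v x s) (at s within {t k..<t (Suc k)})) \<and>
     (\<forall>k\<ge>1. \<exists>l. (x \<longlongrightarrow> l) (at_left (t k)) \<and> x (t k) = I (\<omega> (t k)) *v l)"

definition stable_system ::
    "('p \<Rightarrow> real^'n^'n) \<Rightarrow> ('q \<Rightarrow> real^'n^'n) \<Rightarrow> (real \<Rightarrow> 'p) \<Rightarrow> (nat \<Rightarrow> real) \<Rightarrow> (real \<Rightarrow> 'q) \<Rightarrow> bool"
  where
  "stable_system A I \<sigma> t \<omega> \<longleftrightarrow>
     (\<forall>\<epsilon>>0. \<exists>\<delta>>0. \<forall>x. is_solution A I \<sigma> t \<omega> x \<and> norm (x 0) < \<delta> \<longrightarrow> (\<forall>s>0. norm (x s) < \<epsilon>))"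

section \<open>Dwell and flee times\<close>

(* The maximum over the compact set of impulse matrices is written as a supremum, since Max is
   only meaningful for finite sets; it is attained, because M \<mapsto> ln (c p * spectral_norm (...)) is
   continuous on nonzero M. *)
definition log_gain ::
    "('p \<times> 'p) set \<Rightarrow> (real^'n^'n) set \<Rightarrow> ('p \<Rightarrow> complex^'n^'n) \<Rightarrow> ('p \<Rightarrow> real) \<Rightarrow> ('p \<Rightarrow> real) \<Rightarrow>
      'p \<Rightarrow> real" where
  "log_gain E \<I> P c r p = (MAX q\<in>{q. (p, q) \<in> E}. SUP M\<in>\<I>.
     ln (c p * spectral_norm (matrix_inv (P q) ** cmat M ** P p)) / r p)"

end

theory Submission
  imports Defs
begin

text \<open>On the \<open>k\<close>-th interval use the coordinates \<open>y k = P\<^sub>p\<^sup>-\<^sup>1 x\<close> with \<open>p = \<sigma> (t k)\<close>, in which the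
  flow is \<open>exp (J\<^sub>p s)\<close>. Passing to the coordinates of the next subsystem \<open>q\<close> multiplies by
  \<open>P\<^sub>q\<^sup>-\<^sup>1 M P\<^sub>p\<close>, and the dwell and flee times say precisely that this gain, times the bound on the
  flow over the interval, is at most 1. So the norm of \<open>y k (t k)\<close> does not increase with \<open>k\<close>;
  between switching times the flow is bounded uniformly because \<open>p\<close> ranges over a finite set.\<close>

section \<open>Boundedness of matrix products, and the spectral norm\<close>

lemma bounded_bilinear_matrix_vector_mult:
  "bounded_bilinear ((*v) :: complex^'n^'m \<Rightarrow> complex^'n \<Rightarrow> complex^'m)"
  \<comment> \<open>In finite dimensions every bilinear map is bounded, so linearity in each
    argument is enough.\<close>
  unfolding bilinear_conv_bounded_bilinear[symmetric] bilinear_def linear_iff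
  by (auto simp: algebra_simps vec_eq_iff matrix_vector_mult_def scaleR_sum_right sum.distrib)

lemma bounded_bilinear_matrix_mult:
  "bounded_bilinear ((**) :: complex^'n^'m \<Rightarrow> complex^'k^'n \<Rightarrow> complex^'k^'m)"
  unfolding bilinear_conv_bounded_bilinear[symmetric] bilinear_def linear_iff
  by (auto simp: algebra_simps vec_eq_iff matrix_matrix_mult_def scaleR_sum_right sum.distrib)

interpretation matrix_vector: bounded_bilinear
  "(*v) :: complex^'n^'m \<Rightarrow> complex^'n \<Rightarrow> complex^'m"
  by (rule bounded_bilinear_matrix_vector_mult)

interpretation matrix_mult: bounded_bilinear
  "(**) :: complex^'n^'m \<Rightarrow> complex^'k^'n \<Rightarrow> complex^'k^'m"
  by (rule bounded_bilinear_matrix_mult)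

lemma spectral_norm_bound:
  "norm (A *v x) \<le> spectral_norm A * norm x" for A :: "complex^'n^'m"
  unfolding spectral_norm_def by (rule onorm) (rule matrix_vector.bounded_linear_right)

lemma spectral_norm_nonneg: "0 \<le> spectral_norm A" for A :: "complex^'n^'m"
  unfolding spectral_norm_def by (rule onorm_pos_le) (rule matrix_vector.bounded_linear_right)

lemma spectral_norm_pos: "A \<noteq> 0 \<Longrightarrow> 0 < spectral_norm A" for A :: "complex^'n^'m"
  unfolding spectral_norm_def
  by (subst onorm_pos_lt[OF matrix_vector.bounded_linear_right])
    (metis matrix_eq matrix_vector_mult_0)

text \<open>Compactness of the impulse set gives boundedness in the norm of the type; this carries
  it over to the spectral norm, for which any constant will do.\<close>

lemma spectral_norm_le_norm:
  "\<exists>K. \<forall>A :: complex^'n^'m. spectral_norm A \<le> norm A * K"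
proof -
  obtain K where "\<And>(A :: complex^'n^'m) x. norm (A *v x) \<le> norm A * norm x * K"
    using matrix_vector.bounded by blast
  then have "spectral_norm A \<le> norm A * K" for A :: "complex^'n^'m"
    unfolding spectral_norm_def by (intro onorm_le) (simp add: mult_ac)
  then show ?thesis by blast
qed

section \<open>Matrix exponential and linear differential equations\<close>

lemma matrix_pow_scaleR:
  "matrix_pow (s *\<^sub>R J) k = s ^ k *\<^sub>R matrix_pow J k" for J :: "complex^'n^'n"
  by (induction k) (simp_all add: matrix_mult.scaleR_left matrix_mult.scaleR_right mult_ac)

text \<open>Differentiating \<open>matrix_pow J k *v y r\<close> along the equation produces the new
  factor \<open>J\<close> on the right, whereas the recursion puts it on the left.\<close>

lemma matrix_pow_Suc_right:
  "matrix_pow J (Suc k) = matrix_pow J k ** J" for J :: "complex^'n^'n"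
  by (induction k) (simp_all add: matrix_mul_assoc)

text \<open>Each factor costs at most \<open>norm J * B\<close>, where \<open>B\<close> comes from
  boundedness of the product; \<open>C\<close> is the norm of the identity. Factorials beat this
  geometric growth, both in the exponential series and in the Taylor remainder.\<close>

lemma norm_matrix_pow_le:
  fixes J :: "complex^'n^'n"
  obtains C K where "0 \<le> C" "0 \<le> K" "\<And>k. norm (matrix_pow J k) \<le> C * K ^ k"
proof -
  obtain B where B: "0 \<le> B"
      "\<And>(X :: complex^'n^'n) (Y :: complex^'n^'n). norm (X ** Y) \<le> norm X * norm Y * B"
    using matrix_mult.nonneg_bounded by blast
  have "norm (matrix_pow J k) \<le> norm (mat 1 :: complex^'n^'n) * (norm J * B) ^ k" for k
  proof (induction k)
    case (Suc k)
    have "norm (matrix_pow J (Suc k)) \<le> norm J * norm (matrix_pow J k) * B"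
      using B(2) by simp
    also have "\<dots> \<le> norm J * (norm (mat 1 :: complex^'n^'n) * (norm J * B) ^ k) * B"
      by (intro mult_right_mono mult_left_mono Suc B) auto
    finally show ?case by (simp add: mult_ac)
  qed simp
  with B(1) show ?thesis
    by (intro that[of "norm (mat 1 :: complex^'n^'n)" "norm J * B"]) auto
qed

text \<open>\<open>matrix_exp\<close> is a \<open>suminf\<close>, which is meaningful only once the
  series converges; the scalar exponential series of \<open>\<bar>s\<bar> * K\<close> dominates
  it.\<close>

lemma matrix_exp_sums:
  fixes J :: "complex^'n^'n"
  shows "(\<lambda>k. (s ^ k / fact k) *\<^sub>R matrix_pow J k) sums matrix_exp (s *\<^sub>R J)"
proof -
  obtain C K where CK: "0 \<le> C" "0 \<le> K" "\<And>k. norm (matrix_pow J k) \<le> C * K ^ k"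
    using norm_matrix_pow_le[of J] by blast
  have "summable (\<lambda>k. C * (inverse (fact k) * (\<bar>s\<bar> * K) ^ k))"
    by (intro summable_mult summable_exp)
  moreover have "norm ((s ^ k / fact k) *\<^sub>R matrix_pow J k) \<le>
      C * (inverse (fact k) * (\<bar>s\<bar> * K) ^ k)" for k
  proof -
    have "\<bar>s\<bar> ^ k / fact k * norm (matrix_pow J k) \<le> \<bar>s\<bar> ^ k / fact k * (C * K ^ k)"
      by (intro mult_left_mono CK) auto
    then show ?thesis
      by (simp add: power_abs power_mult_distrib field_simps)
  qed
  ultimately have "summable (\<lambda>k. (s ^ k / fact k) *\<^sub>R matrix_pow J k)"
    by (rule summable_comparison_test'[where N = 0])
  then show ?thesis
    unfolding matrix_exp_def by (simp add: matrix_pow_scaleR summable_sums)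
qed

text \<open>The Taylor polynomials \<open>\<Sum>k\<le>N. (s - r)^k / k! J^k y(r)\<close> of \<open>y\<close> at \<open>r\<close>, evaluated at \<open>s\<close>,
  have a telescoping \<open>r\<close>-derivative that vanishes uniformly as \<open>N\<close> grows; hence their values at
  \<open>r = s\<close> and \<open>r = a\<close> agree in the limit.\<close>

lemma linear_ode_solution:
  fixes J :: "complex^'n^'n" and y :: "real \<Rightarrow> complex^'n"
  assumes ode: "\<And>r. r \<in> {a..s} \<Longrightarrow> (y has_vector_derivative J *v y r) (at r within {a..s})"
    and "a \<le> s"
  shows "y s = matrix_exp ((s - a) *\<^sub>R J) *v y a"
proof -
  define S where "S N r = (\<Sum>k\<le>N. ((s - r) ^ k / fact k) *\<^sub>R (matrix_pow J k *v y r))" for N r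
  have deriv: "(S N has_vector_derivative
      ((s - r) ^ N / fact N) *\<^sub>R (matrix_pow J (Suc N) *v y r)) (at r within {a..s})"
    if r: "r \<in> {a..s}" for N r
  proof (induction N)
    case 0
    then show ?case
      using ode[OF r] by (simp add: S_def[abs_def])
  next
    case (Suc N)
    have 1: "((\<lambda>r. (s - r) ^ Suc N / fact (Suc N)) has_real_derivative - ((s - r) ^ N / fact N))
        (at r within {a..s})"
      by (rule derivative_eq_intros refl | simp add: field_simps del: of_nat_Suc)+
    have 2: "((\<lambda>r. matrix_pow J (Suc N) *v y r) has_vector_derivative
        matrix_pow J (Suc (Suc N)) *v y r) (at r within {a..s})"
      using bounded_linear.has_vector_derivative[OF matrix_vector.bounded_linear_right ode[OF r],
          of "matrix_pow J (Suc N)"]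
      by (simp only: matrix_pow_Suc_right[of J "Suc N"] matrix_vector_mul_assoc)
    \<comment> \<open>In the product rule for the new term, the derivative of the coefficient
      cancels the derivative of \<open>S N\<close>; only the term with the next power of
      \<open>J\<close> remains.\<close>
    have "S (Suc N) = (\<lambda>r. S N r + ((s - r) ^ Suc N / fact (Suc N)) *\<^sub>R (matrix_pow J (Suc N) *v y r))"
      by (auto simp: S_def)
    then show ?case
      using has_vector_derivative_add[OF Suc has_vector_derivative_scaleR[OF 1 2]]
      by (simp only:) (simp add: algebra_simps)
  qed
  have "continuous_on {a..s} y"
    using ode has_vector_derivative_continuous continuous_on_eq_continuous_within by blast
  then have "bounded (y ` {a..s})"
    using compact_continuous_image compact_imp_bounded compact_Icc by blast
  then obtain Y where Y: "\<And>r. r \<in> {a..s} \<Longrightarrow> norm (y r) \<le> Y"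
    unfolding bounded_iff by blast
  have "0 \<le> Y"
    by (rule order_trans[OF norm_ge_zero Y[of a]]) (use \<open>a \<le> s\<close> in simp)
  obtain C K where CK: "0 \<le> C" "0 \<le> K" "\<And>k. norm (matrix_pow J k) \<le> C * K ^ k"
    using norm_matrix_pow_le[of J] by blast
  obtain D where D: "0 \<le> D"
      "\<And>(A :: complex^'n^'n) x. norm (A *v x) \<le> norm A * norm x * D"
    using matrix_vector.nonneg_bounded by blast
  define L where "L = s - a"
  \<comment> \<open>A bound on the derivative of \<open>S N\<close> over all of
    \<open>{a..s}\<close>, to be used in the mean value inequality: \<open>L\<close> bounds
    \<open>s - r\<close>, \<open>Y\<close> bounds \<open>y\<close>, and \<open>D\<close> is the
    constant of the matrix-vector product.\<close>
  define b where "b N = L ^ N / fact N * (C * K ^ Suc N * Y * D)" for N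
  have bound: "norm (S N s - S N a) \<le> b N * norm (s - a)" for N
  proof (rule differentiable_bound[of "{a..s}"])
    show "(S N has_derivative (\<lambda>h. h *\<^sub>R (((s - r) ^ N / fact N) *\<^sub>R (matrix_pow J (Suc N) *v y r))))
        (at r within {a..s})" if "r \<in> {a..s}" for r
      using deriv[OF that] by (simp add: has_vector_derivative_def)
    show "onorm (\<lambda>h. h *\<^sub>R (((s - r) ^ N / fact N) *\<^sub>R (matrix_pow J (Suc N) *v y r))) \<le> b N"
      if r: "r \<in> {a..s}" for r
    proof (rule onorm_le)
      fix h :: real
      have "norm (matrix_pow J (Suc N) *v y r) \<le> norm (matrix_pow J (Suc N)) * norm (y r) * D"
        by (rule D)
      also have "\<dots> \<le> C * K ^ Suc N * Y * D"
        by (intro mult_mono CK(3) Y r D order_refl mult_nonneg_nonneg CK zero_le_power \<open>0 \<le> Y\<close>) auto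
      finally have "(s - r) ^ N / fact N * norm (matrix_pow J (Suc N) *v y r) \<le> b N"
        unfolding b_def L_def using r
        by (intro mult_mono divide_right_mono power_mono) auto
      then have "\<bar>h\<bar> * ((s - r) ^ N / fact N * norm (matrix_pow J (Suc N) *v y r)) \<le> \<bar>h\<bar> * b N"
        by (intro mult_left_mono) auto
      then show "norm (h *\<^sub>R (((s - r) ^ N / fact N) *\<^sub>R (matrix_pow J (Suc N) *v y r))) \<le> b N * norm h"
        using r by (simp add: abs_mult mult_ac del: matrix_pow.simps)
    qed
  qed (use \<open>a \<le> s\<close> in auto)
  \<comment> \<open>Up to a constant factor, \<open>b N\<close> is the general term of the
    convergent exponential series of \<open>L * K\<close>.\<close>
  have "(\<lambda>N. inverse (fact N) * (L * K) ^ N) \<longlonglongrightarrow> 0"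
    by (rule summable_LIMSEQ_zero[OF summable_exp])
  from tendsto_mult_right_zero[OF this, of "C * K * Y * D * norm (s - a)"]
  have "(\<lambda>N. b N * norm (s - a)) \<longlonglongrightarrow> 0"
    by (simp add: b_def power_mult_distrib field_simps)
  then have "(\<lambda>N. S N s - S N a) \<longlonglongrightarrow> 0"
    by (rule Lim_null_comparison[rotated]) (use bound in auto)
  \<comment> \<open>At \<open>r = s\<close> only the term \<open>k = 0\<close> survives, since
    \<open>0 ^ 0 = 1\<close>.\<close>
  moreover have "S N s = y s" for N
    by (induction N) (simp_all add: S_def)
  moreover have "(\<lambda>N. S N a) \<longlonglongrightarrow> matrix_exp ((s - a) *\<^sub>R J) *v y a"
  proof -
    have "(\<lambda>N. (\<Sum>k\<le>N. ((s - a) ^ k / fact k) *\<^sub>R matrix_pow J k) *v y a)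
        \<longlonglongrightarrow> matrix_exp ((s - a) *\<^sub>R J) *v y a"
      using matrix_exp_sums[of "s - a" J]
      by (intro matrix_vector.tendsto tendsto_const) (simp add: sums_def_le)
    then show ?thesis
      by (simp add: S_def matrix_vector.sum_left matrix_vector.scaleR_left)
  qed
  ultimately have "(\<lambda>N. y s - S N a) \<longlonglongrightarrow> 0" "(\<lambda>N. y s - S N a) \<longlonglongrightarrow> y s - matrix_exp ((s - a) *\<^sub>R J) *v y a"
    by (auto intro: tendsto_diff)
  then show ?thesis
    using LIMSEQ_unique by fastforce
qed

section \<open>Complexification of real vectors and matrices\<close>

definition cvec :: "real^'n \<Rightarrow> complex^'n" where
  "cvec x = (\<chi> i. complex_of_real (x $ i))"

text \<open>Jordan coordinates are complex even for real states; because the embedding is isometric,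
  bounds obtained there are bounds on the real state.\<close>

lemma norm_cvec [simp]: "norm (cvec x) = norm x"
  by (simp add: cvec_def norm_vec_def)

lemma bounded_linear_cvec: "bounded_linear cvec"
  by (rule bounded_linear_intro[of _ 1])
    (simp_all add: cvec_def vec_eq_iff norm_vec_def scaleR_conv_of_real[where 'a = complex])

lemma cvec_matrix_vector_mult: "cvec (A *v x) = cmat A *v cvec x"
  by (simp add: cvec_def cmat_def vec_eq_iff matrix_vector_mult_def)

lemma cmat_eq_0_iff: "cmat A = 0 \<longleftrightarrow> A = 0"
  by (simp add: cmat_def vec_eq_iff)

lemma linear_cmat: "linear cmat"
  by (auto simp: linear_iff cmat_def vec_eq_iff scaleR_conv_of_real[where 'a = complex])

section \<open>Gains of the impulses in Jordan coordinates\<close>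

lemma matrix_inv_mult:
  fixes P :: "complex^'n^'n"
  assumes "invertible P"
  shows "P ** matrix_inv P = mat 1" "matrix_inv P ** P = mat 1"
  using assms unfolding invertible_def matrix_inv_def by (metis (mono_tags, lifting) someI_ex)+

text \<open>A \<open>SUP\<close> dominates its members only if they are bounded above, which
  compactness provides. Positivity of the gain, from nonzero \<open>M\<close> and invertible
  coordinate changes, makes \<open>ln\<close> monotone here and lets \<open>exp\<close> undo it
  later.\<close>

lemma ln_gain_le_log_gain:
  fixes \<I> :: "(real^'n^'n) set" and P :: "'p::finite \<Rightarrow> complex^'n^'n"
  assumes "compact \<I>" "0 \<notin> \<I>" "\<And>p. invertible (P p)" "0 < c p" "0 < r p" "(p, q) \<in> E" "M \<in> \<I>"
  defines "\<And>q M. gain q M \<equiv> spectral_norm (matrix_inv (P q) ** cmat M ** P p)"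
  shows "0 < gain q M" "ln (c p * gain q M) \<le> r p * log_gain E \<I> P c r p"
proof -
  have pos: "0 < gain q M" if "M \<in> \<I>" for q M
    unfolding gain_def
  proof (rule spectral_norm_pos, rule notI)
    assume "matrix_inv (P q) ** cmat M ** P p = 0"
    \<comment> \<open>Multiplying the coordinate changes away on both sides leaves
      \<open>cmat M\<close> itself.\<close>
    then have "P q ** (matrix_inv (P q) ** cmat M ** P p) ** matrix_inv (P p) = 0"
      by simp
    then have "(P q ** matrix_inv (P q)) ** cmat M ** (P p ** matrix_inv (P p)) = 0"
      by (simp only: matrix_mul_assoc)
    then have "cmat M = 0"
      by (simp add: matrix_inv_mult assms)
    then show False
      using that \<open>0 \<notin> \<I>\<close> by (simp add: cmat_eq_0_iff)
  qed
  then show "0 < gain q M" using \<open>M \<in> \<I>\<close> .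
  have "bdd_above ((\<lambda>M. ln (c p * gain q M) / r p) ` \<I>)"
  proof -
    obtain K where K: "\<And>A :: complex^'n^'n. spectral_norm A \<le> norm A * K"
      using spectral_norm_le_norm by blast
    let ?f = "\<lambda>M. matrix_inv (P q) ** cmat M ** P p"
    have "bounded_linear ?f"
      using bounded_linear_compose[OF matrix_mult.bounded_linear_left
          bounded_linear_compose[OF matrix_mult.bounded_linear_right
            linear_cmat[unfolded linear_conv_bounded_linear]]] .
    then have "bounded (?f ` \<I>)"
      using bounded_linear_image compact_imp_bounded \<open>compact \<I>\<close> by blast
    then obtain B where B: "\<And>M. M \<in> \<I> \<Longrightarrow> norm (?f M) \<le> B"
      unfolding bounded_iff by blast
    \<comment> \<open>Only an upper bound is needed, so gains close to 0 do no harm. The absolute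
      value is taken because \<open>K\<close> comes without a sign.\<close>
    have "ln (c p * gain q M) / r p \<le> ln (c p * (B * \<bar>K\<bar>)) / r p" if "M \<in> \<I>" for M
    proof -
      have "gain q M \<le> norm (?f M) * \<bar>K\<bar>"
        unfolding gain_def by (rule order_trans[OF K]) (intro mult_left_mono, auto)
      also have "\<dots> \<le> B * \<bar>K\<bar>"
        by (intro mult_right_mono B that) auto
      finally show ?thesis
        using pos[OF that, of q] assms by (intro divide_right_mono ln_mono mult_left_mono) auto
    qed
    then show ?thesis by (auto intro!: bdd_aboveI2)
  qed
  then have "ln (c p * gain q M) / r p \<le> (SUP M\<in>\<I>. ln (c p * gain q M) / r p)"
    by (intro cSUP_upper \<open>M \<in> \<I>\<close>)
  also have "\<dots> \<le> log_gain E \<I> P c r p"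
    unfolding log_gain_def gain_def using \<open>(p, q) \<in> E\<close> by (intro Max_ge) auto
  finally show "ln (c p * gain q M) \<le> r p * log_gain E \<I> P c r p"
    using \<open>0 < r p\<close> by (simp add: field_simps)
qed

section \<open>Stability under arbitrary impulses\<close>

theorem theorem6p2:
  fixes A :: "'p::finite \<Rightarrow> real^'n^'n"
    and I :: "'q \<Rightarrow> real^'n^'n"
    and E :: "('p \<times> 'p) set"
    and P J :: "'p \<Rightarrow> complex^'n^'n"
    and c lam mu \<tau> \<eta> :: "'p \<Rightarrow> real"
    and \<sigma> :: "real \<Rightarrow> 'p"
    and t :: "nat \<Rightarrow> real"
  assumes "\<And>p. stable_matrix (A p) \<or> unstable_matrix (A p)"
    and "compact (range I)"
    and "\<And>q. I q \<noteq> 0"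
    and "\<And>p. \<exists>q. (p, q) \<in> E"
    and "\<And>p. jordan_decomposition (A p) (P p) (J p)"
    and "\<And>p. c p > 0"
    and "\<And>p. stable_matrix (A p) \<Longrightarrow> lam p > 0"
    and "\<And>p. unstable_matrix (A p) \<Longrightarrow> mu p > 0"
    and "\<And>p s. stable_matrix (A p) \<Longrightarrow> s > 0 \<Longrightarrow>
           spectral_norm (matrix_exp (s *\<^sub>R J p)) \<le> c p * exp (- lam p * s)"
    and "\<And>p s. unstable_matrix (A p) \<Longrightarrow> s > 0 \<Longrightarrow>
           spectral_norm (matrix_exp (s *\<^sub>R J p)) \<le> c p * exp (mu p * s)"
    and "\<And>p. stable_matrix (A p) \<Longrightarrow> \<tau> p = log_gain E (range I) P c lam p"
    and "\<And>p. unstable_matrix (A p) \<Longrightarrow> \<eta> p = - log_gain E (range I) P c mu p"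
    and "switching_signal \<sigma> t"
    and "admissible E \<sigma> t"
    and "dwell_flee {p. stable_matrix (A p)} {p. unstable_matrix (A p)} \<tau> \<eta> \<sigma> t"
  shows "\<forall>\<omega> :: real \<Rightarrow> 'q. stable_system A I \<sigma> t \<omega>"
proof (intro allI)
  fix \<omega> :: "real \<Rightarrow> 'q"
  have inv: "invertible (P p)" for p
    using assms(5) by (simp add: jordan_decomposition_def)
  \<comment> \<open>This intertwining turns the equation for \<open>x\<close> into
    \<open>y' = J y\<close> for \<open>y = P\<^sub>p\<^sup>-\<^sup>1 x\<close>.\<close>
  have JP: "J p ** matrix_inv (P p) = matrix_inv (P p) ** cmat (A p)" for p
    using assms(5)[of p] inv[of p]
    by (simp add: jordan_decomposition_def matrix_mul_assoc matrix_inv_mult)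
  have t0: "t 0 = 0" and mono: "strict_mono t" and lim: "filterlim t at_top sequentially"
      and const: "\<And>k. \<sigma> constant_on {t k..<t (Suc k)}"
    using assms(13) by (auto simp: switching_signal_def)
  have less: "t k < t (Suc k)" for k
    using mono by (simp add: strict_mono_Suc_iff)
  have \<sigma>_eq: "\<sigma> s = \<sigma> (t k)" if "s \<in> {t k..<t (Suc k)}" for s k
    using const[of k] that less[of k] by (fastforce simp: constant_on_def)
  have edge: "(\<sigma> (t k), \<sigma> (t (Suc k))) \<in> E" for k
    using assms(14) by (auto simp: admissible_def dest: spec[of _ "Suc k"])
  have dwell: "\<tau> (\<sigma> (t k)) \<le> t (Suc k) - t k" if "stable_matrix (A (\<sigma> (t k)))" for k
    using assms(15) that by (auto simp: dwell_flee_def)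
  have flee: "t (Suc k) - t k \<le> \<eta> (\<sigma> (t k))" if "unstable_matrix (A (\<sigma> (t k)))" for k
    using assms(15) that by (auto simp: dwell_flee_def)
  note gain = ln_gain_le_log_gain[of "range I" P c, OF assms(2) _ inv assms(6)]
  \<comment> \<open>A single flow bound with a signed rate, so that stable and unstable intervals
    can share the rest of the argument.\<close>
  define g where "g p s = c p * exp ((if stable_matrix (A p) then - lam p else mu p) * s)" for p s
  have exp_le: "spectral_norm (matrix_exp (s *\<^sub>R J p)) \<le> g p s" if "0 < s" for p s
    using assms(1)[of p] assms(9,10)[of p s] that by (auto simp: g_def)
  have contract: "spectral_norm (matrix_inv (P (\<sigma> (t (Suc k)))) ** cmat (I i) ** P (\<sigma> (t k))) *
      g (\<sigma> (t k)) (t (Suc k) - t k) \<le> 1" (is "?G * _ \<le> 1") for k i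
  proof -
    let ?p = "\<sigma> (t k)"
    let ?T = "t (Suc k) - t k"
    have I0: "0 \<notin> range I" using assms(3) by (metis imageE)
    \<comment> \<open>The claim in logarithmic form. If stable,
      \<open>ln (c * G) \<le> lam * \<tau> \<le> lam * T\<close>; if unstable,
      \<open>ln (c * G) \<le> - mu * \<eta> \<le> - mu * T\<close>.\<close>
    have "?G > 0 \<and> ln (c ?p * ?G) + (if stable_matrix (A ?p) then - lam ?p else mu ?p) * ?T \<le> 0"
    proof (cases "stable_matrix (A ?p)")
      case True
      note G = gain[where r = lam, OF I0 assms(7)[OF True] edge[of k] rangeI[of I i]]
      have "lam ?p * log_gain E (range I) P c lam ?p \<le> lam ?p * ?T"
        using dwell[OF True] assms(7,11)[OF True] by (intro mult_left_mono) auto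
      with G True show ?thesis by auto
    next
      case False
      then have u: "unstable_matrix (A ?p)" using assms(1) by blast
      note G = gain[where r = mu, OF I0 assms(8)[OF u] edge[of k] rangeI[of I i]]
      have "mu ?p * ?T \<le> mu ?p * - log_gain E (range I) P c mu ?p"
        using flee[OF u] assms(8,12)[OF u] by (intro mult_left_mono) auto
      with G False show ?thesis by auto
    qed
    then have "?G > 0" and
      "exp (ln (c ?p * ?G) + (if stable_matrix (A ?p) then - lam ?p else mu ?p) * ?T) \<le> 1"
      by auto
    then show ?thesis
      using assms(6)[of ?p] by (simp only: exp_add) (simp add: g_def mult_ac)
  qed
  \<comment> \<open>Bounds the flow within an interval together with the return to the original
    coordinates. The 1 covers the left endpoint, where the flow is the identity; the absolute values
    keep the exponent nonnegative also for stable \<open>p\<close>, where nothing is known about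
    \<open>mu p\<close> and \<open>\<eta> p\<close>.\<close>
  define b where "b p = spectral_norm (P p) * max 1 (c p * exp (\<bar>mu p\<bar> * \<bar>\<eta> p\<bar>))" for p
  have b_nonneg: "0 \<le> b p" for p
    by (auto simp: b_def intro!: mult_nonneg_nonneg spectral_norm_nonneg)
  \<comment> \<open>On a stable interval the exponent is at most 0; on an unstable one the flee time
    caps the elapsed time.\<close>
  have g_le: "g (\<sigma> (t k)) (s - t k) \<le> c (\<sigma> (t k)) * exp (\<bar>mu (\<sigma> (t k))\<bar> * \<bar>\<eta> (\<sigma> (t k))\<bar>)"
    if s: "s \<in> {t k<..<t (Suc k)}" for k s
  proof -
    let ?p = "\<sigma> (t k)"
    have "(if stable_matrix (A ?p) then - lam ?p else mu ?p) * (s - t k) \<le> \<bar>mu ?p\<bar> * \<bar>\<eta> ?p\<bar>"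
    proof (cases "stable_matrix (A ?p)")
      case True
      then have "0 \<le> lam ?p * (s - t k)"
        using assms(7)[OF True] s by (intro mult_nonneg_nonneg) auto
      then show ?thesis
        using True by (auto intro: order_trans[of _ 0])
    next
      case False
      then have u: "unstable_matrix (A ?p)" using assms(1) by blast
      have "mu ?p * (s - t k) \<le> \<bar>mu ?p\<bar> * \<bar>\<eta> ?p\<bar>"
        using flee[OF u] s by (intro mult_mono) auto
      then show ?thesis using False by simp
    qed
    then show ?thesis
      using assms(6)[of ?p] by (simp add: g_def)
  qed
  \<comment> \<open>The sum serves as an upper bound for every \<open>b p\<close>, so
    \<open>K\<close> depends on neither the solution nor the time.\<close>
  define K where "K = (\<Sum>p\<in>UNIV. b p) * spectral_norm (matrix_inv (P (\<sigma> 0)))"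
  have "0 \<le> K"
    by (simp add: K_def sum_nonneg b_nonneg spectral_norm_nonneg)
  have bound: "norm (x s) \<le> K * norm (x 0)" if x: "is_solution A I \<sigma> t \<omega> x" and "0 \<le> s" for x s
  proof -
    define y where "y k r = matrix_inv (P (\<sigma> (t k))) *v cvec (x r)" for k r
    have y_le: "norm (y k r) \<le> g (\<sigma> (t k)) (r - t k) * norm (y k (t k))"
      if r: "r \<in> {t k<..<t (Suc k)}" for k r
    proof -
      let ?p = "\<sigma> (t k)"
      \<comment> \<open>Stopping at \<open>r < t (Suc k)\<close> gives a closed interval on which
        the equation holds, before the jump.\<close>
      have "(y k has_vector_derivative J ?p *v y k u) (at u within {t k..r})" if u: "u \<in> {t k..r}" for u
      proof -
        have u': "u \<in> {t k..<t (Suc k)}" using u r by auto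
        then have "(x has_vector_derivative A ?p *v x u) (at u within {t k..<t (Suc k)})"
          using x u' unfolding is_solution_def \<sigma>_eq[OF u', symmetric] by blast
        then have "(x has_vector_derivative A ?p *v x u) (at u within {t k..r})"
          by (rule has_vector_derivative_within_subset) (use r in auto)
        from bounded_linear.has_vector_derivative[OF matrix_vector.bounded_linear_right
            bounded_linear.has_vector_derivative[OF bounded_linear_cvec this]]
        show ?thesis
          unfolding y_def by (simp add: cvec_matrix_vector_mult matrix_vector_mul_assoc JP)
      qed
      then have "y k r = matrix_exp ((r - t k) *\<^sub>R J ?p) *v y k (t k)"
        using r by (intro linear_ode_solution) auto
      then have "norm (y k r) \<le> spectral_norm (matrix_exp ((r - t k) *\<^sub>R J ?p)) * norm (y k (t k))"
        by (simp add: spectral_norm_bound)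
      also have "\<dots> \<le> g ?p (r - t k) * norm (y k (t k))"
        using r by (intro mult_right_mono exp_le) auto
      finally show ?thesis .
    qed
    have step: "norm (y (Suc k) (t (Suc k))) \<le> norm (y k (t k))" for k
    proof -
      let ?p = "\<sigma> (t k)"
      obtain l where l: "(x \<longlongrightarrow> l) (at_left (t (Suc k)))"
          "x (t (Suc k)) = I (\<omega> (t (Suc k))) *v l"
        using x by (force simp: is_solution_def)
      \<comment> \<open>The left limit of \<open>y k\<close> at \<open>t (Suc k)\<close>; the value
        of \<open>y k\<close> there already contains the jump. The estimate \<open>y_le\<close>
        passes to this limit with the full interval length.\<close>
      define z where "z = matrix_inv (P ?p) *v cvec l"
      have "((\<lambda>r. norm (y k r)) \<longlongrightarrow> norm z) (at_left (t (Suc k)))"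
        unfolding y_def z_def
        by (intro tendsto_norm matrix_vector.tendsto tendsto_const
            bounded_linear.tendsto[OF bounded_linear_cvec] l)
      moreover have "((\<lambda>r. g ?p (r - t k) * norm (y k (t k))) \<longlongrightarrow>
          g ?p (t (Suc k) - t k) * norm (y k (t k))) (at_left (t (Suc k)))"
        unfolding g_def by (intro tendsto_intros)
      moreover have "\<forall>\<^sub>F r in at_left (t (Suc k)).
          norm (y k r) \<le> g ?p (r - t k) * norm (y k (t k))"
        using eventually_at_leftI[OF y_le less] .
      ultimately have z: "norm z \<le> g ?p (t (Suc k) - t k) * norm (y k (t k))"
        by (intro tendsto_le[OF trivial_limit_at_left_real])
      \<comment> \<open>Leaving the old coordinates, jumping, and entering the new ones, combined in
        one matrix: the one that \<open>contract\<close> controls.\<close>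
      let ?G = "matrix_inv (P (\<sigma> (t (Suc k)))) ** cmat (I (\<omega> (t (Suc k)))) ** P ?p"
      have "cvec l = P ?p *v z"
        by (simp add: z_def matrix_vector_mul_assoc matrix_inv_mult inv)
      then have "y (Suc k) (t (Suc k)) = ?G *v z"
        by (simp add: y_def l cvec_matrix_vector_mult matrix_vector_mul_assoc matrix_mul_assoc)
      then have "norm (y (Suc k) (t (Suc k))) \<le> spectral_norm ?G * norm z"
        by (simp add: spectral_norm_bound)
      also have "\<dots> \<le> spectral_norm ?G * g ?p (t (Suc k) - t k) * norm (y k (t k))"
        using mult_left_mono[OF z spectral_norm_nonneg, of ?G] by (simp add: mult.assoc)
      also have "\<dots> \<le> 1 * norm (y k (t k))"
        by (intro mult_right_mono contract) auto
      finally show ?thesis by simp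
    qed
    have y_le_y0: "norm (y k (t k)) \<le> norm (y 0 0)" for k
      by (induction k) (auto simp: t0 intro: order_trans[OF step])
    have "\<exists>k. s < t k"
      using lim unfolding filterlim_at_top_dense eventually_sequentially by blast
    then obtain n where "s < t n" ..
    moreover have "\<not> s < t 0" using \<open>0 \<le> s\<close> t0 by simp
    \<comment> \<open>The first index \<open>n\<close> with \<open>s < t n\<close> is not 0, hence
      has a predecessor, and that is \<open>k\<close>.\<close>
    ultimately obtain k where k: "t k \<le> s" "s < t (Suc k)"
      using ex_least_nat_less[of "\<lambda>k. s < t k" n] by (auto simp: not_less)
    let ?p = "\<sigma> (t k)"
    have "norm (y k s) \<le> max 1 (c ?p * exp (\<bar>mu ?p\<bar> * \<bar>\<eta> ?p\<bar>)) * norm (y k (t k))"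
    proof (cases "s = t k")
      case True
      then show ?thesis by (simp add: mult_le_cancel_right1)
    next
      case False
      then have s: "s \<in> {t k<..<t (Suc k)}" using k by auto
      show ?thesis
        by (rule order_trans[OF y_le[OF s]])
          (intro mult_right_mono norm_ge_zero max.coboundedI2 g_le[OF s])
    qed
    also have "\<dots> \<le> max 1 (c ?p * exp (\<bar>mu ?p\<bar> * \<bar>\<eta> ?p\<bar>)) * norm (y 0 0)"
      by (intro mult_left_mono y_le_y0) auto
    finally have y_s: "norm (y k s) \<le> max 1 (c ?p * exp (\<bar>mu ?p\<bar> * \<bar>\<eta> ?p\<bar>)) * norm (y 0 0)" .
    have "cvec (x s) = P ?p *v y k s"
      by (simp add: y_def matrix_vector_mul_assoc matrix_inv_mult inv)
    then have "norm (x s) \<le> spectral_norm (P ?p) * norm (y k s)"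
      by (metis norm_cvec spectral_norm_bound)
    also have "\<dots> \<le> b ?p * norm (y 0 0)"
      using mult_left_mono[OF y_s spectral_norm_nonneg, of "P ?p"] by (simp add: b_def mult.assoc)
    also have "\<dots> \<le> (\<Sum>p\<in>UNIV. b p) * (spectral_norm (matrix_inv (P (\<sigma> 0))) * norm (x 0))"
    proof (intro mult_mono)
      show "norm (y 0 0) \<le> spectral_norm (matrix_inv (P (\<sigma> 0))) * norm (x 0)"
        unfolding y_def t0 by (metis norm_cvec spectral_norm_bound)
    qed (auto intro!: member_le_sum sum_nonneg b_nonneg)
    finally show ?thesis by (simp add: K_def mult.assoc)
  qed
  show "stable_system A I \<sigma> t \<omega>"
    unfolding stable_system_def
  proof (intro allI impI)
    fix \<epsilon> :: real assume "0 < \<epsilon>"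
    show "\<exists>\<delta>>0. \<forall>x. is_solution A I \<sigma> t \<omega> x \<and> norm (x 0) < \<delta> \<longrightarrow> (\<forall>s>0. norm (x s) < \<epsilon>)"
    \<comment> \<open>Adding 1 keeps the denominator positive when \<open>K = 0\<close>.\<close>
    proof (intro exI[of _ "\<epsilon> / (K + 1)"] conjI allI impI)
      show "0 < \<epsilon> / (K + 1)" using \<open>0 < \<epsilon>\<close> \<open>0 \<le> K\<close> by simp
      fix x and s :: real
      assume x: "is_solution A I \<sigma> t \<omega> x \<and> norm (x 0) < \<epsilon> / (K + 1)" and "0 < s"
      then have "norm (x s) \<le> K * norm (x 0)" by (intro bound) auto
      also have "\<dots> \<le> (K + 1) * norm (x 0)" by (simp add: distrib_right)
      also have "\<dots> < \<epsilon>" using x \<open>0 \<le> K\<close> by (simp add: field_simps)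
      finally show "norm (x s) < \<epsilon>" .
    qed
  qed
qed

end
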